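(* Let $g\ge 0$, $r\ge 1$ and $d$ be integers with $d\ge g+r$. Then the number of $L$-tableaux with parameters $(g,r,d)$ is $(r+1)^g$.
   Context: Young diagrams are drawn in the French convention (left- and bottom-justified, with the longest row at the bottom). An $L$-tableau with parameters $(g,r,d)$ is a filling of all boxes of a grid with $r+1$ rows and $d-r$ columns with $rg$ "red" integers and $(d-r)(r+1)-rg$ "blue" integers such that: (1) the boxes containing red integers are left-and-bottom justified, i.e. they form the Young diagram of a partition placed in the lower left corner of the grid; the red integers weakly increase from bottom to top up columns and strictly increase from left to right across rows; and they consist of the numbers $1,2,\ldots,g$, each occurring exactly $r$ times; (2) the blue integers occupy the remaining boxes of the grid (hence are right-and-top justified), have values in $\{0,1,\ldots,r\}$ (with any multiplicities), strictly increase from bottom to top up columns, and weakly increase from left to right across rows. There is no order condition between red and blue integers. *)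

theory Defs
  imports Main "HOL-Library.FuncSet"
begin

datatype entry = Red nat | Blue nat

text \<open>Boxes are pairs \<open>(i, j)\<close>: row \<open>i\<close> counted from the bottom, column \<open>j\<close> counted from the
  left, both starting at 0.\<close>

definition grid :: "nat \<Rightarrow> nat \<Rightarrow> (nat \<times> nat) set" where
  "grid r d = {0..<r + 1} \<times> {0..<d - r}"

text \<open>A partition is a weakly decreasing sequence of naturals with finitely many nonzero parts.\<close>

definition is_partition :: "(nat \<Rightarrow> nat) \<Rightarrow> bool" where
  "is_partition p \<longleftrightarrow> antimono p \<and> finite {i. p i \<noteq> 0}"

definition young_diagram :: "(nat \<Rightarrow> nat) \<Rightarrow> (nat \<times> nat) set" where
  "young_diagram p = {(i, j). j < p i}"

definition red_boxes :: "nat \<Rightarrow> nat \<Rightarrow> (nat \<times> nat \<Rightarrow> entry) \<Rightarrow> (nat \<times> nat) set" where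
  "red_boxes r d T = {b \<in> grid r d. \<exists>a. T b = Red a}"

definition blue_boxes :: "nat \<Rightarrow> nat \<Rightarrow> (nat \<times> nat \<Rightarrow> entry) \<Rightarrow> (nat \<times> nat) set" where
  "blue_boxes r d T = {b \<in> grid r d. \<exists>a. T b = Blue a}"

definition red_condition :: "nat \<Rightarrow> nat \<Rightarrow> nat \<Rightarrow> (nat \<times> nat \<Rightarrow> entry) \<Rightarrow> bool" where
  "red_condition g r d T \<longleftrightarrow>
     (\<exists>p. is_partition p \<and> red_boxes r d T = young_diagram p) \<and>
     (\<forall>i i' j a a'. (i, j) \<in> grid r d \<and> (i', j) \<in> grid r d \<and> i < i' \<and>
        T (i, j) = Red a \<and> T (i', j) = Red a' \<longrightarrow> a \<le> a') \<and>
     (\<forall>i j j' a a'. (i, j) \<in> grid r d \<and> (i, j') \<in> grid r d \<and> j < j' \<and>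
        T (i, j) = Red a \<and> T (i, j') = Red a' \<longrightarrow> a < a') \<and>
     (\<forall>b \<in> grid r d. \<forall>a. T b = Red a \<longrightarrow> a \<in> {1..g}) \<and>
     (\<forall>a \<in> {1..g}. card {b \<in> grid r d. T b = Red a} = r)"

definition blue_condition :: "nat \<Rightarrow> nat \<Rightarrow> (nat \<times> nat \<Rightarrow> entry) \<Rightarrow> bool" where
  "blue_condition r d T \<longleftrightarrow>
     (\<forall>b \<in> grid r d. \<forall>a. T b = Blue a \<longrightarrow> a \<in> {0..r}) \<and>
     (\<forall>i i' j a a'. (i, j) \<in> grid r d \<and> (i', j) \<in> grid r d \<and> i < i' \<and>
        T (i, j) = Blue a \<and> T (i', j) = Blue a' \<longrightarrow> a < a') \<and>
     (\<forall>i j j' a a'. (i, j) \<in> grid r d \<and> (i, j') \<in> grid r d \<and> j < j' \<and>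
        T (i, j) = Blue a \<and> T (i, j') = Blue a' \<longrightarrow> a \<le> a')"

text \<open>Fillings are extensional functions on the grid, so that each filling is counted once.
  The number of blue boxes is stated additively to avoid truncated subtraction.\<close>

definition L_tableaux :: "nat \<Rightarrow> nat \<Rightarrow> nat \<Rightarrow> (nat \<times> nat \<Rightarrow> entry) set" where
  "L_tableaux g r d = {T \<in> grid r d \<rightarrow>\<^sub>E UNIV.
     card (red_boxes r d T) = r * g \<and>
     card (blue_boxes r d T) + r * g = (d - r) * (r + 1) \<and>
     red_condition g r d T \<and> blue_condition r d T}"

end

theory Submission
  imports Defs
begin

text \<open>
  Put \<open>n = r + 1\<close> for the number of rows. A red letter occurs at most once in a row, because rows
  increase strictly, and it occurs \<open>r\<close> times in all; hence it is missing from exactly one row.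
  The red part of a tableau is therefore recorded by the word \<open>w\<close> that sends each letter in
  \<open>{1..g}\<close> to the row without it. The letter \<open>a\<close> of row \<open>i\<close> sits in the column whose index is the
  number of smaller letters in that row, so \<open>w\<close> determines all red boxes. The condition on columns
  says that \<open>w\<close> is a ballot word: in each prefix, a lower row is omitted at most as often as a
  higher one.

  Row \<open>i\<close> then has \<open>c + m i\<close> blue boxes, where \<open>c = d - r - g\<close> and \<open>m i\<close> is the number of letters
  omitted from row \<open>i\<close>. After a reflection that exchanges left and right, the blue part is a
  semistandard filling with values below \<open>n\<close>, with row lengths that increase weakly upwards.
  Removing its zeros, which include the whole bottom row, leaves such a filling with \<open>n - 1\<close> rows
  whose lengths interlace with the old ones. So these fillings are counted by Gelfand-Tsetlin
  patterns (\<open>card_semistandard\<close>).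

  It remains to sum the number of patterns over all ballot words. Reading one more letter of a word
  lengthens one row of the shape, and the Pieri rule for a single box (\<open>pieri_gt_count\<close>) says that
  the pattern numbers of all shapes obtained from one shape in this way add up to \<open>n\<close> times its own.
  So each letter contributes a factor \<open>n\<close>, starting from the value \<open>1\<close> for the rectangle in which
  every row has length \<open>c\<close> (\<open>sum_gt_count_ballot_words\<close>). The sum is \<open>n ^ g\<close>, which amounts to the
  enumerative content of the Robinson-Schensted-Knuth correspondence for words.
\<close>

section \<open>Counting Gelfand-Tsetlin patterns\<close>

definition interlacing :: "nat \<Rightarrow> (nat \<Rightarrow> nat) \<Rightarrow> (nat \<Rightarrow> nat) set" where
  "interlacing n b = (\<Pi>\<^sub>E i\<in>{..<n}. {b i..b (Suc i)})"

text \<open>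
  The number of Gelfand-Tsetlin patterns whose longest row is \<open>b 0, ..., b (n - 1)\<close>. Rows are
  weakly increasing here, in the order in which the row lengths of the blue shape appear from bottom
  to top.
\<close>

primrec gt_count :: "nat \<Rightarrow> (nat \<Rightarrow> nat) \<Rightarrow> nat" where
  "gt_count 0 b = 1"
| "gt_count (Suc n) b = (\<Sum>c\<in>interlacing n b. gt_count n c)"

lemma finite_interlacing: "finite (interlacing n b)"
  unfolding interlacing_def by (intro finite_PiE) auto

text \<open>
  A row that is not weakly increasing has an adjacent descent, and then one of the intervals that
  the next row has to meet is empty.
\<close>

lemma gt_count_eq_0:
  assumes "i < i'" "i' < n" "b i' < b i"
  shows "gt_count n b = 0"
proof -
  have "\<exists>k. Suc k < n \<and> b (Suc k) < b k"
  proof (rule ccontr)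
    assume "\<not> ?thesis"
    then have adjacent: "\<And>k. Suc k < n \<Longrightarrow> b k \<le> b (Suc k)" by (meson not_le)
    from \<open>i < i'\<close> have "i \<le> i'" by simp
    then have "i' < n \<longrightarrow> b i \<le> b i'"
    proof (induction rule: dec_induct)
      case (step k)
      then show ?case using adjacent[of k] by auto
    qed simp
    then show False using assms by simp
  qed
  then obtain k where k: "Suc k < n" "b (Suc k) < b k" by blast
  then obtain n' where n': "n = Suc n'" by (cases n) auto
  have "interlacing n' b = {}"
    using k n' by (auto simp: interlacing_def PiE_eq_empty_iff)
  then show ?thesis using n' by simp
qed

lemma gt_count_const:
  assumes "\<And>i. i < n \<Longrightarrow> b i = c"
  shows "gt_count n b = 1"
  using assms
proof (induction n arbitrary: b)
  case (Suc n)
  have "interlacing n b = (\<Pi>\<^sub>E i\<in>{..<n}. {c})"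
    unfolding interlacing_def by (rule PiE_cong) (use Suc.prems in auto)
  also have "\<dots> = {\<lambda>i\<in>{..<n}. c}"
    by (simp add: PiE_eq_singleton)
  finally show ?case by (simp add: Suc.IH)
qed simp

text \<open>
  Lengthening part \<open>i\<close> of \<open>b\<close> raises the lower bound for entry \<open>i\<close> of the next row and the upper bound
  for entry \<open>i - 1\<close>. The next rows are split according to whether entry \<open>i - 1\<close> takes its new
  value. If it does not, only the raised lower bound is felt (or nothing at all, when \<open>i = n\<close>). If it
  does, the raised lower bound may be ignored: the rows this adds have a descent from entry \<open>i - 1\<close> to
  entry \<open>i\<close> and hence begin no pattern. The purpose of this form is that the same two kinds of sums
  come up when a box is added to the next row instead.
\<close>

lemma gt_count_add_box:
  assumes mono: "\<And>i. i < n \<Longrightarrow> b i \<le> b (Suc i)" and "i \<le> n"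
  defines "B \<equiv> \<lambda>i. {b i..b (Suc i)}"
  shows "gt_count (Suc n) (b(i := Suc (b i))) =
    (\<Sum>c\<in>(if i < n then PiE {..<n} (B(i := {Suc (b i)..b (Suc i)})) else PiE {..<n} B). gt_count n c) +
    (if i = 0 then 0 else \<Sum>c\<in>PiE {..<n} (B(i - 1 := {Suc (b i)})). gt_count n c)"
proof -
  define I where "I = interlacing n (b(i := Suc (b i)))"
  define A where "A = (if i < n then PiE {..<n} (B(i := {Suc (b i)..b (Suc i)})) else PiE {..<n} B)"
  define E where "E = PiE {..<n} (B(i - 1 := {Suc (b i)}))"
  define X where "X = {c \<in> I. i \<noteq> 0 \<and> c (i - 1) = Suc (b i)}"
  have finI: "finite I" by (simp add: I_def finite_interlacing)
  have IA: "{c \<in> I. \<not> (i \<noteq> 0 \<and> c (i - 1) = Suc (b i))} = A"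
  proof (intro set_eqI iffI)
    fix c assume c: "c \<in> {c \<in> I. \<not> (i \<noteq> 0 \<and> c (i - 1) = Suc (b i))}"
    have ext: "c \<in> extensional {..<n}" using c by (auto simp: I_def interlacing_def PiE_def)
    have bd: "\<And>k. k < n \<Longrightarrow> c k \<in> {(b(i := Suc (b i))) k..(b(i := Suc (b i))) (Suc k)}"
      using c by (auto simp: I_def interlacing_def PiE_def Pi_def)
    have *: "c k \<in> (if k = i then {Suc (b i)..b (Suc i)} else B k)" if k: "k < n" for k
      using bd[OF k] c by (cases "Suc k = i") (auto simp: B_def split: if_splits)
    show "c \<in> A" using * ext unfolding A_def PiE_def Pi_def by (auto)
  next
    fix c assume c: "c \<in> A"
    have ext: "c \<in> extensional {..<n}" using c by (auto simp: A_def PiE_def split: if_splits)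
    have bd: "c k \<in> (if k = i then {Suc (b i)..b (Suc i)} else B k)" if "k < n" for k
      using c that \<open>i \<le> n\<close> unfolding A_def PiE_def Pi_def by (auto split: if_splits)
    have "c k \<in> {(b(i := Suc (b i))) k..(b(i := Suc (b i))) (Suc k)}" if "k < n" for k
      using bd[OF that] by (auto simp: B_def split: if_splits)
    then have "c \<in> I" using ext by (auto simp: I_def interlacing_def PiE_def Pi_def)
    moreover have "\<not> (i \<noteq> 0 \<and> c (i - 1) = Suc (b i))"
      using bd[of "i - 1"] \<open>i \<le> n\<close> by (cases i) (auto simp: B_def)
    ultimately show "c \<in> {c \<in> I. \<not> (i \<noteq> 0 \<and> c (i - 1) = Suc (b i))}" by simp
  qed
  \<comment> \<open>\<open>E\<close> differs from \<open>X\<close> by the rows with \<open>c i = b i < c (i - 1)\<close>, which count zero.\<close>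
  have XE: "(\<Sum>c\<in>X. gt_count n c) = (if i = 0 then 0 else \<Sum>c\<in>E. gt_count n c)"
  proof (cases i)
    case (Suc l)
    have sub: "X \<subseteq> E"
    proof
      fix c assume c: "c \<in> X"
      have bd: "\<And>k. k < n \<Longrightarrow> c k \<in> {(b(i := Suc (b i))) k..(b(i := Suc (b i))) (Suc k)}"
        using c by (auto simp: X_def I_def interlacing_def PiE_def Pi_def)
      have "c k \<in> (B(i - 1 := {Suc (b i)})) k" if k: "k < n" for k
        using bd[OF k] c Suc by (auto simp: B_def X_def split: if_splits)
      moreover have "c \<in> extensional {..<n}" using c by (auto simp: X_def I_def interlacing_def PiE_def)
      ultimately show "c \<in> E" by (auto simp: E_def PiE_def)
    qed
    have "gt_count n c = 0" if c: "c \<in> E - X" for c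
    proof -
      have bd: "c k \<in> (B(i - 1 := {Suc (b i)})) k" if "k < n" for k
        using PiE_mem[of c "{..<n}" "B(i - 1 := {Suc (b i)})" k] c that unfolding E_def by blast
      have ext: "c \<in> extensional {..<n}" using c by (auto simp: E_def PiE_def)
      have l: "l < n" "c l = Suc (b i)" using bd[of l] Suc \<open>i \<le> n\<close> by auto
      have "i < n \<and> c i \<le> b i"
      proof (rule ccontr)
        assume a: "\<not> (i < n \<and> c i \<le> b i)"
        have "c k \<in> {(b(i := Suc (b i))) k..(b(i := Suc (b i))) (Suc k)}" if k: "k < n" for k
          using bd[OF k] a k l Suc mono[of l] by (auto simp: B_def split: if_splits)
        then have "c \<in> X" using ext l Suc by (auto simp: X_def I_def interlacing_def PiE_def Pi_def)
        then show False using c by simp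
      qed
      then show ?thesis using gt_count_eq_0[of l i n c] l Suc by simp
    qed
    moreover have "finite E" unfolding E_def by (intro finite_PiE) (auto simp: B_def)
    ultimately have "(\<Sum>c\<in>X. gt_count n c) = (\<Sum>c\<in>E. gt_count n c)"
      using sub by (intro sum.mono_neutral_left) auto
    then show ?thesis using Suc by simp
  qed (simp add: X_def)
  have "gt_count (Suc n) (b(i := Suc (b i))) = (\<Sum>c\<in>I. gt_count n c)"
    by (simp add: I_def)
  also have "\<dots> = (\<Sum>c\<in>A. gt_count n c) + (\<Sum>c\<in>X. gt_count n c)"
  proof -
    have "I = A \<union> X" "A \<inter> X = {}" unfolding IA[symmetric] X_def by auto
    then show ?thesis using finI by (simp add: sum.union_disjoint)
  qed
  finally show ?thesis unfolding XE A_def E_def .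
qed

lemma fun_upd_PiE:
  assumes "c \<in> PiE S B" "j \<in> S" "y \<in> Y"
  shows "c(j := y) \<in> PiE S (B(j := Y))"
  using assms by (auto simp: PiE_iff extensional_def)

text \<open>
  Adding a box to entry \<open>j\<close> shifts the interval of admissible values up by one; what matters is
  whether the shifted entry stays within its old upper bound or exceeds it.
\<close>

lemma sum_gt_count_add_box_interlacing:
  assumes "j < n" "b j \<le> b (Suc j)"
  defines "B \<equiv> \<lambda>i. {b i..b (Suc i)}"
  shows "(\<Sum>c\<in>PiE {..<n} B. gt_count n (c(j := Suc (c j)))) =
    (\<Sum>c\<in>PiE {..<n} (B(j := {Suc (b j)..b (Suc j)})). gt_count n c) +
    (\<Sum>c\<in>PiE {..<n} (B(j := {Suc (b (Suc j))})). gt_count n c)"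
proof -
  let ?S = "PiE {..<n} (B(j := {Suc (b j)..Suc (b (Suc j))}))"
  let ?A = "PiE {..<n} (B(j := {Suc (b j)..b (Suc j)}))"
  let ?E = "PiE {..<n} (B(j := {Suc (b (Suc j))}))"
  have "bij_betw (\<lambda>c. c(j := Suc (c j))) (PiE {..<n} B) ?S"
  proof (rule bij_betw_byWitness[where f' = "\<lambda>c. c(j := c j - 1)"])
    have S: "c j \<in> {Suc (b j)..Suc (b (Suc j))}" if "c \<in> ?S" for c
      using PiE_mem[OF that, of j] \<open>j < n\<close> by simp
    show "\<forall>c\<in>PiE {..<n} B. (c(j := Suc (c j)))(j := (c(j := Suc (c j))) j - 1) = c" by simp
    show "\<forall>c\<in>?S. (c(j := c j - 1))(j := Suc ((c(j := c j - 1)) j)) = c"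
    proof
      fix c assume "c \<in> ?S"
      then have "Suc (c j - 1) = c j" using S by fastforce
      then show "(c(j := c j - 1))(j := Suc ((c(j := c j - 1)) j)) = c" by simp
    qed
    show "(\<lambda>c. c(j := Suc (c j))) ` PiE {..<n} B \<subseteq> ?S"
    proof (rule image_subsetI)
      fix c assume c: "c \<in> PiE {..<n} B"
      have "c j \<in> B j" using PiE_mem[OF c, of j] \<open>j < n\<close> by simp
      then have "Suc (c j) \<in> {Suc (b j)..Suc (b (Suc j))}" by (simp add: B_def)
      then show "c(j := Suc (c j)) \<in> ?S"
        using fun_upd_PiE[OF c] \<open>j < n\<close> by simp
    qed
    show "(\<lambda>c. c(j := c j - 1)) ` ?S \<subseteq> PiE {..<n} B"
    proof (rule image_subsetI)
      fix c assume c: "c \<in> ?S"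
      have "c j - 1 \<in> B j" using S[OF c] by (auto simp: B_def)
      then show "c(j := c j - 1) \<in> PiE {..<n} B"
        using fun_upd_PiE[OF c, of j "c j - 1" "B j"] \<open>j < n\<close> by simp
    qed
  qed
  then have "(\<Sum>c\<in>PiE {..<n} B. gt_count n (c(j := Suc (c j)))) = (\<Sum>c\<in>?S. gt_count n c)"
    by (rule sum.reindex_bij_betw)
  also have "?S = ?A \<union> ?E"
  proof (intro set_eqI iffI)
    fix c assume c: "c \<in> ?S"
    show "c \<in> ?A \<union> ?E"
      using c by (cases "c j = Suc (b (Suc j))") (auto simp: PiE_def Pi_def split: if_splits)
  qed (use assms in \<open>auto simp: PiE_def Pi_def split: if_splits\<close>)
  also have "(\<Sum>c\<in>?A \<union> ?E. gt_count n c) = (\<Sum>c\<in>?A. gt_count n c) + (\<Sum>c\<in>?E. gt_count n c)"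
  proof (rule sum.union_disjoint)
    show "finite ?A" "finite ?E" by (intro finite_PiE; auto simp: B_def)+
    show "?A \<inter> ?E = {}"
    proof (rule ccontr)
      assume "?A \<inter> ?E \<noteq> {}"
      then obtain c where "c \<in> ?A" "c \<in> ?E" by blast
      then have "c j \<in> {Suc (b j)..b (Suc j)}" "c j \<in> {Suc (b (Suc j))}"
        using \<open>j < n\<close> by (auto simp: PiE_def Pi_def)
      then show False by simp
    qed
  qed
  finally show ?thesis .
qed

text \<open>
  Pieri's rule for one box, at the level of dimensions: the vector representation of \<open>GL n\<close> tensored
  with the representation of highest weight \<open>b\<close> is the sum of the representations whose weights
  arise from \<open>b\<close> by adding a box. Increments that destroy monotonicity contribute zero by
  \<open>gt_count_eq_0\<close>, so the sum runs over all parts. In the induction, the terms given by the previous two lemmas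
  match term by term; the one left over, from the last part of \<open>b\<close>, is the pattern number of \<open>b\<close>
  itself and turns the factor \<open>n\<close> into \<open>n + 1\<close>.
\<close>

lemma pieri_gt_count:
  assumes "\<And>i. Suc i < n \<Longrightarrow> b i \<le> b (Suc i)"
  shows "(\<Sum>i<n. gt_count n (b(i := Suc (b i)))) = n * gt_count n b"
  using assms
proof (induction n arbitrary: b)
  case (Suc n)
  define B where "B = (\<lambda>i. {b i..b (Suc i)})"
  define I where "I = PiE {..<n} B"
  define A where "A = (\<lambda>j. \<Sum>c\<in>PiE {..<n} (B(j := {Suc (b j)..b (Suc j)})). gt_count n c)"
  define E where "E = (\<lambda>j. \<Sum>c\<in>PiE {..<n} (B(j := {Suc (b (Suc j))})). gt_count n c)"
  have mono: "\<And>i. i < n \<Longrightarrow> b i \<le> b (Suc i)" using Suc.prems by simp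
  have I: "gt_count (Suc n) b = (\<Sum>c\<in>I. gt_count n c)"
    by (simp add: I_def interlacing_def B_def)
  have "(\<Sum>i<Suc n. gt_count (Suc n) (b(i := Suc (b i)))) =
      (\<Sum>i<Suc n. (if i < n then A i else gt_count (Suc n) b) + (if i = 0 then 0 else E (i - 1)))"
  proof (rule sum.cong[OF refl])
    fix i assume "i \<in> {..<Suc n}"
    then have "i \<le> n" by simp
    note gt_count_add_box[of n b i, OF mono this]
    then show "gt_count (Suc n) (b(i := Suc (b i))) =
       (if i < n then A i else gt_count (Suc n) b) + (if i = 0 then 0 else E (i - 1))"
      unfolding I I_def A_def E_def B_def by (cases i) (auto split: if_splits)
  qed
  also have "\<dots> = (\<Sum>i<Suc n. if i < n then A i else gt_count (Suc n) b)
      + (\<Sum>i<Suc n. if i = 0 then 0 else E (i - 1))"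
    by (rule sum.distrib)
  also have "(\<Sum>i<Suc n. if i < n then A i else gt_count (Suc n) b) = (\<Sum>i<n. A i) + gt_count (Suc n) b"
    by simp
  also have "(\<Sum>i<Suc n. if i = 0 then 0 else E (i - 1)) = (\<Sum>i<n. E i)"
    by (subst sum.lessThan_Suc_shift) simp
  also have "(\<Sum>i<n. A i) + gt_count (Suc n) b + (\<Sum>i<n. E i) =
      (\<Sum>j<n. A j + E j) + gt_count (Suc n) b"
    by (simp add: sum.distrib)
  also have "(\<Sum>j<n. A j + E j) = (\<Sum>j<n. \<Sum>c\<in>I. gt_count n (c(j := Suc (c j))))"
    unfolding A_def E_def I_def B_def
    by (intro sum.cong refl sum_gt_count_add_box_interlacing[symmetric]) (use mono in auto)
  also have "\<dots> = (\<Sum>c\<in>I. \<Sum>j<n. gt_count n (c(j := Suc (c j))))"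
    by (rule sum.swap)
  also have "\<dots> = (\<Sum>c\<in>I. n * gt_count n c)"
  proof (rule sum.cong[OF refl])
    fix c assume c: "c \<in> I"
    show "(\<Sum>j<n. gt_count n (c(j := Suc (c j)))) = n * gt_count n c"
    proof (rule Suc.IH)
      fix i assume "Suc i < n"
      then have "c i \<in> B i" "c (Suc i) \<in> B (Suc i)" using c by (auto simp: I_def PiE_def Pi_def)
      then show "c i \<le> c (Suc i)" by (simp add: B_def)
    qed
  qed
  also have "\<dots> = n * gt_count (Suc n) b" by (simp only: I sum_distrib_left)
  finally show ?case by simp
qed simp

section \<open>Semistandard fillings\<close>

definition boxes :: "nat \<Rightarrow> (nat \<Rightarrow> nat) \<Rightarrow> (nat \<times> nat) set" where
  "boxes n b = {(i, j). i < n \<and> j < b i}"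

text \<open>
  Rows are left-justified, listed from bottom to top, and weakly decreasing: the mirror image of the
  blue part of a tableau. For weakly increasing \<open>b\<close> every column extends up to the top row.
\<close>

definition semistandard :: "nat \<Rightarrow> (nat \<Rightarrow> nat) \<Rightarrow> (nat \<times> nat \<Rightarrow> nat) set" where
  "semistandard n b = {f \<in> boxes n b \<rightarrow>\<^sub>E {..<n}.
     (\<forall>i i' j. i < i' \<longrightarrow> (i, j) \<in> boxes n b \<longrightarrow> (i', j) \<in> boxes n b \<longrightarrow> f (i, j) < f (i', j)) \<and>
     (\<forall>i j j'. j < j' \<longrightarrow> (i, j') \<in> boxes n b \<longrightarrow> f (i, j') \<le> f (i, j))}"

lemma finite_boxes: "finite (boxes n b)"
proof -
  have "boxes n b = (SIGMA i:{..<n}. {..<b i})" by (auto simp: boxes_def)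
  then show ?thesis by simp
qed

lemma finite_semistandard: "finite (semistandard n b)"
  by (rule finite_subset[of _ "boxes n b \<rightarrow>\<^sub>E {..<n}"])
     (auto simp: semistandard_def intro!: finite_PiE finite_boxes)

lemma down_closed_eq_lessThan_card:
  fixes S :: "nat set"
  assumes "finite S" and "\<And>x y. x \<in> S \<Longrightarrow> y < x \<Longrightarrow> y \<in> S"
  shows "S = {..<card S}"
proof (cases "S = {}")
  case False
  have "S = {..Max S}"
  proof
    show "S \<subseteq> {..Max S}" using assms(1) by auto
    show "{..Max S} \<subseteq> S"
      using Max_in[OF assms(1) False] assms(2) le_neq_implies_less by blast
  qed
  moreover from this have "card S = Suc (Max S)" by (metis card_atMost)
  ultimately show ?thesis by (simp add: lessThan_Suc_atMost)
qed simp

text \<open>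
  Inverse of the operation that removes all zeros together with the bottom row and lowers the
  remaining values by one; \<open>c i\<close> is the number of positive entries in row \<open>i + 1\<close>.
\<close>

definition glue_zeros :: "nat \<Rightarrow> (nat \<Rightarrow> nat) \<Rightarrow> (nat \<Rightarrow> nat) \<times> (nat \<times> nat \<Rightarrow> nat) \<Rightarrow> nat \<times> nat \<Rightarrow> nat" where
  "glue_zeros n b = (\<lambda>(c, f). \<lambda>(i, j)\<in>boxes (Suc n) b.
     if 0 < i \<and> j < c (i - 1) then Suc (f (i - 1, j)) else 0)"

lemma glue_zeros_Suc:
  assumes "i < n" "j < b (Suc i)"
  shows "glue_zeros n b (c, f) (Suc i, j) = (if j < c i then Suc (f (i, j)) else 0)"
  using assms by (simp add: glue_zeros_def boxes_def)

lemma glue_zeros_0: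
  assumes "j < b 0"
  shows "glue_zeros n b (c, f) (0, j) = 0"
  using assms by (simp add: glue_zeros_def boxes_def)

lemma interlacingD:
  "c \<in> interlacing n b \<Longrightarrow> i < n \<Longrightarrow> b i \<le> c i \<and> c i \<le> b (Suc i)"
  by (auto simp: interlacing_def PiE_def Pi_def)

text \<open>
  A column strictly increases even where it meets the glued zeros: if its box in row \<open>i\<close> exists, then
  interlacing makes every box above it one with a positive entry.
\<close>

lemma glue_zeros_semistandard:
  assumes c: "c \<in> interlacing n b" and f: "f \<in> semistandard n c"
  shows "glue_zeros n b (c, f) \<in> semistandard (Suc n) b"
proof -
  let ?F = "glue_zeros n b (c, f)"
  have fr: "\<And>i j. i < n \<Longrightarrow> j < c i \<Longrightarrow> f (i, j) < n"
    using f by (auto simp: semistandard_def boxes_def PiE_def Pi_def)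
  have fc: "\<And>i i' j. i < i' \<Longrightarrow> i' < n \<Longrightarrow> j < c i \<Longrightarrow> j < c i' \<Longrightarrow> f (i, j) < f (i', j)"
    using f by (auto simp: semistandard_def boxes_def)
  have fw: "\<And>i j j'. j < j' \<Longrightarrow> i < n \<Longrightarrow> j' < c i \<Longrightarrow> f (i, j') \<le> f (i, j)"
    using f by (auto simp: semistandard_def boxes_def)
  have cm: "c i \<le> c i'" if "i \<le> i'" "i' < n" for i i'
    using that
  proof (induction rule: dec_induct)
    case (step k)
    then show ?case using interlacingD[OF c, of k] interlacingD[OF c, of "Suc k"] by simp
  qed simp
  have range: "?F (i, j) < Suc n" if "(i, j) \<in> boxes (Suc n) b" for i j
    using that fr[of "i - 1" j] by (cases i) (auto simp: glue_zeros_def boxes_def)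
  have cols: "?F (i, j) < ?F (i', j)"
    if ij: "i < i'" "(i, j) \<in> boxes (Suc n) b" "(i', j) \<in> boxes (Suc n) b" for i i' j
  proof -
    obtain k' where k': "i' = Suc k'" using ij(1) by (cases i') auto
    have "k' < n" "j < b i'" "j < b i" using that k' by (auto simp: boxes_def)
    have "b i \<le> c i" using interlacingD[OF c, of i] that k' \<open>k' < n\<close> by auto
    also have "c i \<le> c k'" using cm[of i k'] that k' \<open>k' < n\<close> by auto
    finally have jc: "j < c k'" using \<open>j < b i\<close> by simp
    have F': "?F (i', j) = Suc (f (k', j))"
      using glue_zeros_Suc[OF \<open>k' < n\<close>, of j b c f] jc k' \<open>j < b i'\<close> by simp
    show ?thesis
    proof (cases i)
      case 0
      then show ?thesis using F' glue_zeros_0[of j b n c f] \<open>j < b i\<close> by simp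
    next
      case (Suc k)
      have "k < n" using Suc that k' by (auto simp: boxes_def)
      then show ?thesis using Suc glue_zeros_Suc[of k n j b c f] \<open>j < b i\<close> F' fc[of k k' j] jc \<open>k' < n\<close> that k'
        by (auto split: if_splits)
    qed
  qed
  have rows: "?F (i, j') \<le> ?F (i, j)" if "j < j'" "(i, j') \<in> boxes (Suc n) b" for i j j'
    using that fw[of j j' "i - 1"] by (cases i) (auto simp: glue_zeros_def boxes_def)
  have "?F \<in> extensional (boxes (Suc n) b)" by (simp add: glue_zeros_def)
  then show ?thesis using range cols rows by (auto simp: semistandard_def PiE_def Pi_def)
qed

lemma inj_on_glue_zeros:
  "inj_on (glue_zeros n b) (SIGMA c:interlacing n b. semistandard n c)"
proof (rule inj_onI, clarify)
  fix c f c' f'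
  assume c: "c \<in> interlacing n b" and f: "f \<in> semistandard n c"
    and c': "c' \<in> interlacing n b" and f': "f' \<in> semistandard n c'"
    and eq: "glue_zeros n b (c, f) = glue_zeros n b (c', f')"
  have eq': "(if j < c i then Suc (f (i, j)) else 0) = (if j < c' i then Suc (f' (i, j)) else 0)"
    if "i < n" "j < b (Suc i)" for i j
    using eq glue_zeros_Suc[where b = b, OF that, of c f] glue_zeros_Suc[where b = b, OF that, of c' f'] by simp
  have "c i = c' i" if i: "i < n" for i
  proof -
    have "j < c i \<longleftrightarrow> j < c' i" for j
      using eq'[OF i, of j] interlacingD[OF c i] interlacingD[OF c' i]
      by (cases "j < b (Suc i)") (auto split: if_splits)
    then show ?thesis by (metis linorder_neq_iff less_irrefl)
  qed
  then have cc: "c = c'"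
    using c c' by (intro extensionalityI[of _ "{..<n}"]) (auto simp: interlacing_def PiE_def)
  moreover have "f = f'"
  proof (rule extensionalityI[of _ "boxes n c"])
    show "f \<in> extensional (boxes n c)" "f' \<in> extensional (boxes n c)"
      using f f' cc by (auto simp: semistandard_def PiE_def)
    fix x assume "x \<in> boxes n c"
    then show "f x = f' x"
      using eq'[of "fst x" "snd x"] interlacingD[OF c, of "fst x"] cc by (auto simp: boxes_def)
  qed
  ultimately show "c = c' \<and> f = f'" by simp
qed

text \<open>
  Interlacing comes from the columns: a box above another box has a positive entry, so row \<open>i + 1\<close>
  has at least \<open>b i\<close> positive entries.
\<close>

lemma semistandard_glue_zeros_surj:
  assumes mono: "\<And>i. i < n \<Longrightarrow> b i \<le> b (Suc i)" and F: "F \<in> semistandard (Suc n) b"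
  shows "F \<in> glue_zeros n b ` (SIGMA c:interlacing n b. semistandard n c)"
proof -
  have Fr: "\<And>i j. i < Suc n \<Longrightarrow> j < b i \<Longrightarrow> F (i, j) < Suc n"
    using F by (auto simp: semistandard_def boxes_def PiE_def Pi_def)
  have Fc: "\<And>i i' j. i < i' \<Longrightarrow> i' < Suc n \<Longrightarrow> j < b i \<Longrightarrow> j < b i' \<Longrightarrow> F (i, j) < F (i', j)"
    using F by (auto simp: semistandard_def boxes_def)
  have Fw: "\<And>i j j'. j < j' \<Longrightarrow> i < Suc n \<Longrightarrow> j' < b i \<Longrightarrow> F (i, j') \<le> F (i, j)"
    using F by (auto simp: semistandard_def boxes_def)
  define S where "S = (\<lambda>i. {j. j < b (Suc i) \<and> 0 < F (Suc i, j)})"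
  define c where "c = (\<lambda>i\<in>{..<n}. card (S i))"
  have S: "S i = {..<c i}" if "i < n" for i
  proof -
    have "S i = {..<card (S i)}"
    proof (rule down_closed_eq_lessThan_card)
      fix x y assume "x \<in> S i" "y < x"
      then show "y \<in> S i" using Fw[of y x "Suc i"] that by (auto simp: S_def)
    qed (simp add: S_def)
    then show ?thesis using that by (simp add: c_def)
  qed
  have c: "c \<in> interlacing n b"
    unfolding interlacing_def
  proof (rule PiE_I)
    fix i assume i: "i \<in> {..<n}"
    have "{..<b i} \<subseteq> S i"
    proof
      fix j assume "j \<in> {..<b i}"
      then show "j \<in> S i" using Fc[of i "Suc i" j] mono[of i] i by (auto simp: S_def)
    qed
    moreover have "S i \<subseteq> {..<b (Suc i)}" by (auto simp: S_def)
    ultimately show "c i \<in> {b i..b (Suc i)}" using S[of i] i by auto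
  qed (simp add: c_def)
  \<comment> \<open>The column above \<open>(i, j)\<close> climbs \<open>n - i\<close> steps without exceeding \<open>n\<close>; so the bottom row is zero.\<close>
  have zero: "F (i, j) \<le> i" if "i < Suc n" "j < b i" for i j
  proof -
    have bm: "b i' \<le> b i''" if "i' \<le> i''" "i'' \<le> n" for i' i''
      using that by (induction rule: dec_induct) (use mono in \<open>auto intro: order_trans\<close>)
    have "k \<le> n - i \<Longrightarrow> F (i, j) + k \<le> F (i + k, j)" for k
    proof (induction k)
      case (Suc k)
      have k: "i + Suc k \<le> n" using Suc.prems that by simp
      have "j < b (i + k)" "j < b (i + Suc k)"
        using bm[of i "i + k"] bm[of i "i + Suc k"] k that by auto
      then have "F (i + k, j) < F (i + Suc k, j)" using Fc[of "i + k" "i + Suc k" j] k by auto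
      then show ?case using Suc by simp
    qed simp
    from this[of "n - i"] have "F (i, j) + (n - i) \<le> F (n, j)" using that by simp
    moreover have "F (n, j) < Suc n" using Fr[of n j] bm[of i n] that by auto
    ultimately show ?thesis using that by simp
  qed
  define f where "f = (\<lambda>(i, j)\<in>boxes n c. F (Suc i, j) - 1)"
  have pos: "0 < F (Suc i, j)" "j < b (Suc i)" if "i < n" "j < c i" for i j
    using S[OF that(1)] that(2) by (auto simp: S_def set_eq_iff)
  have fF: "f (i, j) = F (Suc i, j) - 1" if "i < n" "j < c i" for i j
    using that by (simp add: f_def boxes_def)
  have "f \<in> semistandard n c"
  proof -
    have 1: "f (i, j) < n" if "i < n" "j < c i" for i j
      using fF[OF that] pos[OF that] Fr[of "Suc i" j] that by simp
    have 2: "f (i, j) < f (i', j)" if "i < i'" "i' < n" "j < c i" "j < c i'" for i i' j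
      using fF[of i j] fF[of i' j] pos[of i j] pos[of i' j] Fc[of "Suc i" "Suc i'" j] that by simp
    have 3: "f (i, j') \<le> f (i, j)" if "j < j'" "i < n" "j' < c i" for i j j'
      using fF[of i j] fF[of i j'] pos[of i j] pos[of i j'] Fw[of j j' "Suc i"] that by simp
    have "f \<in> extensional (boxes n c)" by (simp add: f_def)
    then show ?thesis using 1 2 3 by (auto simp: semistandard_def boxes_def PiE_def Pi_def)
  qed
  moreover have "F = glue_zeros n b (c, f)"
  proof (rule extensionalityI[of _ "boxes (Suc n) b"])
    show "F \<in> extensional (boxes (Suc n) b)" using F by (auto simp: semistandard_def PiE_def)
    show "glue_zeros n b (c, f) \<in> extensional (boxes (Suc n) b)" by (simp add: glue_zeros_def)
    fix x assume "x \<in> boxes (Suc n) b"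
    then obtain i j where x: "x = (i, j)" "i < Suc n" "j < b i" by (auto simp: boxes_def)
    show "F x = glue_zeros n b (c, f) x"
    proof (cases i)
      case 0
      then show ?thesis using zero[of 0 j] glue_zeros_0[of j b n c f] x by simp
    next
      case (Suc k)
      then have k: "k < n" "j < b (Suc k)" using x by auto
      have "j < c k \<longleftrightarrow> 0 < F (Suc k, j)" using S[OF k(1)] k by (auto simp: S_def set_eq_iff)
      then show ?thesis using glue_zeros_Suc[where b = b, OF k, of c f] fF[OF k(1), of j] x Suc by auto
    qed
  qed
  ultimately show ?thesis using c by (intro image_eqI[of _ _ "(c, f)"]) auto
qed

lemma card_semistandard:
  assumes "\<And>i. Suc i < n \<Longrightarrow> b i \<le> b (Suc i)"
  shows "card (semistandard n b) = gt_count n b"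
  using assms
proof (induction n arbitrary: b)
  case 0
  have "semistandard 0 b = {\<lambda>x. undefined}"
    by (auto simp: semistandard_def boxes_def)
  then show ?case by simp
next
  case (Suc n)
  have "glue_zeros n b ` (SIGMA c:interlacing n b. semistandard n c) = semistandard (Suc n) b"
    using glue_zeros_semistandard semistandard_glue_zeros_surj[of n b] Suc.prems by auto
  then have "card (semistandard (Suc n) b) = card (SIGMA c:interlacing n b. semistandard n c)"
    using card_image[OF inj_on_glue_zeros[of n b]] by simp
  also have "\<dots> = (\<Sum>c\<in>interlacing n b. card (semistandard n c))"
    by (simp add: finite_interlacing finite_semistandard)
  also have "\<dots> = (\<Sum>c\<in>interlacing n b. gt_count n c)"
  proof (rule sum.cong[OF refl], rule Suc.IH)
    fix c i assume "c \<in> interlacing n b" "Suc i < n"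
    then show "c i \<le> c (Suc i)" using interlacingD[of c n b i] interlacingD[of c n b "Suc i"] by simp
  qed
  finally show ?case by simp
qed


section \<open>Ballot words\<close>

text \<open>
  When \<open>w a\<close> is the row that lacks the letter \<open>a\<close>, this is the number of letters up to \<open>k\<close> in row \<open>i\<close>.
\<close>

definition others :: "(nat \<Rightarrow> nat) \<Rightarrow> nat \<Rightarrow> nat \<Rightarrow> nat" where
  "others w i k = card {a \<in> {1..k}. w a \<noteq> i}"

lemma others_0 [simp]: "others w i 0 = 0"
  by (simp add: others_def)

lemma others_Suc: "others w i (Suc k) = (if w (Suc k) = i then others w i k else Suc (others w i k))"
proof -
  have "{a \<in> {1..Suc k}. w a \<noteq> i} =
      (if w (Suc k) = i then {a \<in> {1..k}. w a \<noteq> i} else insert (Suc k) {a \<in> {1..k}. w a \<noteq> i})"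
    by (auto simp: le_Suc_eq)
  then show ?thesis by (simp add: others_def)
qed

lemma others_mono: "k \<le> k' \<Longrightarrow> others w i k \<le> others w i k'"
  unfolding others_def by (intro card_mono) auto

lemma others_le: "others w i k \<le> k"
  by (induction k) (auto simp: others_Suc)

lemma others_cong: "(\<And>a. a \<in> {1..k} \<Longrightarrow> w a = w' a) \<Longrightarrow> others w i k = others w' i k"
  unfolding others_def by (rule arg_cong[of _ _ card]) auto

definition ballot_words :: "nat \<Rightarrow> nat \<Rightarrow> (nat \<Rightarrow> nat) set" where
  "ballot_words n g = {w \<in> {1..g} \<rightarrow>\<^sub>E {..<n}.
     \<forall>k\<le>g. \<forall>i i'. i < i' \<longrightarrow> i' < n \<longrightarrow> others w i' k \<le> others w i k}"

lemma finite_ballot_words: "finite (ballot_words n g)"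
  by (rule finite_subset[of _ "{1..g} \<rightarrow>\<^sub>E {..<n}"]) (auto simp: ballot_words_def intro!: finite_PiE)

text \<open>
  Here \<open>g - others w i g\<close> is the number of letters of \<open>w\<close> equal to \<open>i\<close>. A one-letter extension of a ballot word of
  length \<open>g\<close> that fails to be a ballot word fails at its full length, so its shape has a descent and
  counts zero. Hence all \<open>n\<close> extensions may be included, and Pieri's rule applies to them.
\<close>

lemma sum_gt_count_ballot_words:
  "(\<Sum>w\<in>ballot_words n g. gt_count n (\<lambda>i. c + (g - others w i g))) = n ^ g"
proof (induction g)
  case 0
  have "ballot_words n 0 = {\<lambda>x. undefined}" by (auto simp: ballot_words_def)
  then show ?case by (simp add: gt_count_const)
next
  case (Suc g)
  define sh where "sh = (\<lambda>g w i. c + (g - others w i g))"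
  define X where "X = ballot_words n g \<times> {..<n}"
  define u where "u = (\<lambda>(w, x::nat). w(Suc g := x))"
  have occ: "others (u (w, x)) i k = others w i k" if "k \<le> g" for w x i k
    by (rule others_cong) (use that in \<open>auto simp: u_def\<close>)
  have u_last: "u (w, x) (Suc g) = x" for w x by (simp add: u_def)
  have inj: "inj_on u X"
  proof (rule inj_onI, clarify)
    fix w x w' x'
    assume wx: "(w, x) \<in> X" "(w', x') \<in> X" and eq: "u (w, x) = u (w', x')"
    have "x = x'" using fun_cong[OF eq, of "Suc g"] by (simp add: u_def)
    moreover have "w a = w' a" for a
    proof (cases "a = Suc g")
      case True
      have "w (Suc g) = undefined" "w' (Suc g) = undefined"
        using wx by (auto simp: X_def ballot_words_def PiE_def extensional_def)
      then show ?thesis using True by simp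
    next
      case False
      then show ?thesis using fun_cong[OF eq, of a] by (simp add: u_def)
    qed
    ultimately show "w = w' \<and> x = x'" by blast
  qed
  have sub: "ballot_words n (Suc g) \<subseteq> u ` X"
  proof
    fix v assume v: "v \<in> ballot_words n (Suc g)"
    define w where "w = restrict v {1..g}"
    have vw: "v = u (w, v (Suc g))"
    proof
      fix a show "v a = u (w, v (Suc g)) a"
        using v by (cases "a \<in> {1..g}")
          (auto simp: u_def w_def ballot_words_def PiE_def extensional_def le_Suc_eq)
    qed
    have "others w i k = others v i k" if "k \<le> g" for i k
      by (rule others_cong) (use that in \<open>auto simp: w_def\<close>)
    then have "w \<in> ballot_words n g"
      using v by (auto simp: ballot_words_def w_def PiE_iff)
    moreover have "v (Suc g) < n" using v by (auto simp: ballot_words_def PiE_iff)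
    ultimately show "v \<in> u ` X"
      using vw by (intro image_eqI[of _ _ "(w, v (Suc g))"]) (auto simp: X_def)
  qed
  have zero: "gt_count n (sh (Suc g) v) = 0" if v: "v \<in> u ` X - ballot_words n (Suc g)" for v
  proof -
    obtain w x where w: "w \<in> ballot_words n g" "x < n" "v = u (w, x)" using v by (auto simp: X_def)
    have "v \<in> {1..Suc g} \<rightarrow>\<^sub>E {..<n}"
      using w by (auto simp: u_def ballot_words_def PiE_iff extensional_def le_Suc_eq)
    then obtain k i i' where k: "k \<le> Suc g" "i < i'" "i' < n" "others v i k < others v i' k"
      using v by (auto simp: ballot_words_def not_le)
    have "k = Suc g"
      using k w occ[of k w x] by (cases "k = Suc g") (auto simp: ballot_words_def not_le[symmetric])
    then have "sh (Suc g) v i' < sh (Suc g) v i"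
      using k others_le[of v i' k] by (auto simp: sh_def)
    then show ?thesis using gt_count_eq_0 k by blast
  qed
  have shape: "sh (Suc g) (u (w, x)) = (sh g w)(x := Suc (sh g w x))" for w x
  proof
    fix i
    have "others (u (w, x)) i (Suc g) = (if x = i then others w i g else Suc (others w i g))"
      unfolding others_Suc u_last by (simp add: occ)
    then show "sh (Suc g) (u (w, x)) i = ((sh g w)(x := Suc (sh g w x))) i"
      using others_le[of w i g] by (cases "x = i") (auto simp: sh_def)
  qed
  have "(\<Sum>w\<in>ballot_words n (Suc g). gt_count n (sh (Suc g) w)) = (\<Sum>v\<in>u ` X. gt_count n (sh (Suc g) v))"
    using sub zero by (intro sum.mono_neutral_left) (auto simp: X_def finite_ballot_words)
  also have "\<dots> = (\<Sum>z\<in>X. gt_count n (sh (Suc g) (u z)))"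
    using inj by (simp add: sum.reindex)
  also have "\<dots> = (\<Sum>w\<in>ballot_words n g. \<Sum>x<n. gt_count n (sh (Suc g) (u (w, x))))"
    unfolding X_def by (simp add: sum.cartesian_product)
  also have "\<dots> = (\<Sum>w\<in>ballot_words n g. n * gt_count n (sh g w))"
  proof (rule sum.cong[OF refl])
    fix w assume w: "w \<in> ballot_words n g"
    have "others w (Suc i) g \<le> others w i g" if "Suc i < n" for i
      using w that by (auto simp: ballot_words_def)
    then show "(\<Sum>x<n. gt_count n (sh (Suc g) (u (w, x)))) = n * gt_count n (sh g w)"
      unfolding shape by (intro pieri_gt_count) (simp add: sh_def diff_le_mono2)
  qed
  also have "\<dots> = n * n ^ g"
    using Suc by (simp add: sh_def sum_distrib_left[symmetric])
  finally show ?case by (simp add: sh_def)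
qed

section \<open>Red boxes\<close>

text \<open>
  The entry in column \<open>j\<close> of the increasing list of the letters that row \<open>i\<close> contains: the
  first moment at which the row has more than \<open>j\<close> letters. In this form the weak increase up a column
  is immediate from the ballot condition.
\<close>

definition letter :: "(nat \<Rightarrow> nat) \<Rightarrow> nat \<Rightarrow> nat \<Rightarrow> nat" where
  "letter w i j = (LEAST a. j < others w i a)"

lemma letter_props:
  assumes "j < others w i g"
  shows "letter w i j \<in> {1..g}" "w (letter w i j) \<noteq> i"
    "others w i (letter w i j - 1) = j" "others w i (letter w i j) = Suc j"
proof -
  let ?a = "letter w i j"
  have a: "j < others w i ?a" unfolding letter_def by (rule LeastI[of _ g]) (rule assms)
  have "?a \<le> g" unfolding letter_def by (rule Least_le) (rule assms)
  obtain a' where a': "?a = Suc a'" using a by (cases ?a) auto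
  have "\<not> j < others w i a'" using not_less_Least[of a' "\<lambda>a. j < others w i a"] a'
    by (simp add: letter_def)
  then show "?a \<in> {1..g}" "w ?a \<noteq> i" "others w i (?a - 1) = j" "others w i ?a = Suc j"
    using a a' \<open>?a \<le> g\<close> by (auto simp: others_Suc split: if_splits)
qed

lemma others_less:
  assumes "1 \<le> a" "a \<le> g" "w a \<noteq> i"
  shows "others w i (a - 1) < others w i g"
proof -
  have "others w i a = Suc (others w i (a - 1))" using assms by (cases a) (auto simp: others_Suc)
  then show ?thesis using others_mono[OF assms(2), of w i] by simp
qed

lemma letter_others:
  assumes "1 \<le> a" "w a \<noteq> i"
  shows "letter w i (others w i (a - 1)) = a"
  unfolding letter_def
proof (rule Least_equality)
  show "others w i (a - 1) < others w i a" using others_less[of a a w i] assms by simp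
  fix k assume "others w i (a - 1) < others w i k"
  then show "a \<le> k" using others_mono[of k "a - 1" w i] by linarith
qed

lemma letter_strict_mono:
  assumes "j < j'" "j' < others w i g"
  shows "letter w i j < letter w i j'"
proof (rule ccontr)
  assume "\<not> ?thesis"
  then have "others w i (letter w i j') \<le> others w i (letter w i j)" by (intro others_mono) simp
  then show False using letter_props(4)[of j w i g] letter_props(4)[of j' w i g] assms by simp
qed

section \<open>Decomposing a tableau into its red and its blue part\<close>

definition blue_shape :: "nat \<Rightarrow> nat \<Rightarrow> nat \<Rightarrow> (nat \<Rightarrow> nat) \<Rightarrow> nat \<Rightarrow> nat" where
  "blue_shape g r d w i = (d - r) - others w i g"

definition tableau_of ::
  "nat \<Rightarrow> nat \<Rightarrow> nat \<Rightarrow> (nat \<Rightarrow> nat) \<times> (nat \<times> nat \<Rightarrow> nat) \<Rightarrow> nat \<times> nat \<Rightarrow> entry" where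
  "tableau_of g r d = (\<lambda>(w, f). \<lambda>(i, j)\<in>grid r d.
     if j < others w i g then Red (letter w i j) else Blue (f (i, d - r - 1 - j)))"

lemma tableau_of_apply:
  assumes "i < r + 1" "j < d - r"
  shows "tableau_of g r d (w, f) (i, j) =
    (if j < others w i g then Red (letter w i j) else Blue (f (i, d - r - 1 - j)))"
  using assms by (simp add: tableau_of_def grid_def)

lemma mem_grid: "(i, j) \<in> grid r d \<longleftrightarrow> i < r + 1 \<and> j < d - r"
  by (auto simp: grid_def)

text \<open>
  Each letter \<open>a\<close> occupies one box in every row other than \<open>w a\<close>, which gives the multiplicity \<open>r\<close>
  and all box counts. For \<open>g \<le> d - r\<close> the red rows fit into the grid.
\<close>

lemma tableau_of_in_L_tableaux:
  assumes "g \<le> d - r" and w: "w \<in> ballot_words (r + 1) g"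
    and f: "f \<in> semistandard (r + 1) (blue_shape g r d w)"
  shows "tableau_of g r d (w, f) \<in> L_tableaux g r d"
proof -
  let ?T = "tableau_of g r d (w, f)"
  have len: "others w i g \<le> d - r" for i using others_le[of w i g] assms(1) by simp
  have ballot: "others w i' k \<le> others w i k" if "k \<le> g" "i < i'" "i' < r + 1" for i i' k
    using w that by (auto simp: ballot_words_def)
  have red: "?T (i, j) = Red a \<longleftrightarrow> j < others w i g \<and> letter w i j = a" if "(i, j) \<in> grid r d" for i j a
    using that by (auto simp: tableau_of_apply mem_grid)
  have blue: "?T (i, j) = Blue a \<longleftrightarrow> others w i g \<le> j \<and> f (i, d - r - 1 - j) = a"
    if "(i, j) \<in> grid r d" for i j a
    using that by (auto simp: tableau_of_apply mem_grid)
  define p where "p = (\<lambda>i. if i < r + 1 then others w i g else 0)"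
  have red_boxes: "red_boxes r d ?T = young_diagram p"
  proof (intro set_eqI iffI)
    fix x assume "x \<in> red_boxes r d ?T"
    then obtain i j a where "x = (i, j)" "(i, j) \<in> grid r d" "?T (i, j) = Red a"
      by (cases x) (auto simp: red_boxes_def)
    then show "x \<in> young_diagram p" by (simp add: red young_diagram_def p_def mem_grid)
  next
    fix x assume "x \<in> young_diagram p"
    then obtain i j where x: "x = (i, j)" "i < r + 1" "j < others w i g"
      by (cases x) (auto simp: young_diagram_def p_def split: if_splits)
    then have "(i, j) \<in> grid r d" using len[of i] by (simp add: mem_grid)
    then show "x \<in> red_boxes r d ?T" using x by (simp add: red_boxes_def red)
  qed
  have "antimono p"
  proof (rule antimonoI)
    fix i i' :: nat assume "i \<le> i'"
    then show "p i' \<le> p i" using ballot[of g i i'] by (cases "i = i'") (auto simp: p_def)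
  qed
  moreover have "finite {i. p i \<noteq> 0}"
    by (rule finite_subset[of _ "{..r}"]) (auto simp: p_def)
  ultimately have part: "is_partition p" by (simp add: is_partition_def)
  have fibre: "{b \<in> grid r d. ?T b = Red a} = (\<lambda>i. (i, others w i (a - 1))) ` ({..<r + 1} - {w a})"
    if a: "a \<in> {1..g}" for a
  proof (intro set_eqI iffI)
    fix x assume "x \<in> {b \<in> grid r d. ?T b = Red a}"
    moreover obtain i j where "x = (i, j)" by (cases x)
    ultimately have x: "x = (i, j)" "(i, j) \<in> grid r d" "j < others w i g" "letter w i j = a"
      by (auto simp: red)
    then show "x \<in> (\<lambda>i. (i, others w i (a - 1))) ` ({..<r + 1} - {w a})"
      using letter_props[of j w i g] by (auto simp: mem_grid)
  next
    fix x assume "x \<in> (\<lambda>i. (i, others w i (a - 1))) ` ({..<r + 1} - {w a})"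
    then obtain i where i: "x = (i, others w i (a - 1))" "i < r + 1" "w a \<noteq> i" by auto
    have "others w i (a - 1) < others w i g" using others_less[of a g w i] a i by simp
    then show "x \<in> {b \<in> grid r d. ?T b = Red a}"
      using len[of i] letter_others[of a w i] a i by (auto simp: red mem_grid)
  qed
  have card_fibre: "card {b \<in> grid r d. ?T b = Red a} = r" if a: "a \<in> {1..g}" for a
  proof -
    have "w a < r + 1" using w a by (auto simp: ballot_words_def PiE_iff)
    then have "card ({..<r + 1} - {w a}) = r" by simp
    moreover have "inj_on (\<lambda>i. (i, others w i (a - 1))) ({..<r + 1} - {w a})" by (rule inj_onI) simp
    ultimately show ?thesis unfolding fibre[OF a] by (simp only: card_image)
  qed
  have letters: "a \<in> {1..g}" if "b \<in> grid r d" "?T b = Red a" for a b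
    using that letter_props(1)[of "snd b" w "fst b" g] red[of "fst b" "snd b" a] by auto
  have finite: "finite (grid r d)" by (simp add: grid_def)
  have "red_boxes r d ?T = (\<Union>a\<in>{1..g}. {b \<in> grid r d. ?T b = Red a})"
    using letters by (auto simp: red_boxes_def)
  also have "card \<dots> = (\<Sum>a\<in>{1..g}. card {b \<in> grid r d. ?T b = Red a})"
    by (rule card_UN_disjoint) (use finite in auto)
  also have "\<dots> = r * g" using card_fibre by simp
  finally have card_red: "card (red_boxes r d ?T) = r * g" .
  have "red_boxes r d ?T \<union> blue_boxes r d ?T = grid r d"
    by (auto simp: red_boxes_def blue_boxes_def) (metis entry.exhaust)
  moreover have "red_boxes r d ?T \<inter> blue_boxes r d ?T = {}"
    by (auto simp: red_boxes_def blue_boxes_def)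
  moreover have "finite (red_boxes r d ?T)" "finite (blue_boxes r d ?T)"
    using finite by (auto simp: red_boxes_def blue_boxes_def)
  ultimately have "card (grid r d) = card (red_boxes r d ?T) + card (blue_boxes r d ?T)"
    by (metis card_Un_disjoint)
  then have card_blue: "card (blue_boxes r d ?T) + r * g = (d - r) * (r + 1)"
    using card_red by (simp add: grid_def mult.commute)
  have red_cols: "a \<le> a'" if "(i, j) \<in> grid r d" "(i', j) \<in> grid r d" "i < i'"
    "?T (i, j) = Red a" "?T (i', j) = Red a'" for i i' j a a'
  proof -
    have j: "j < others w i' g" "letter w i j = a" "letter w i' j = a'" using that by (auto simp: red)
    have "a' \<le> g" using letter_props(1)[OF j(1)] j by simp
    have "j < others w i' a'" using letter_props(4)[OF j(1)] j by simp
    also have "others w i' a' \<le> others w i a'"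
      using ballot[of a' i i'] that \<open>a' \<le> g\<close> by (simp add: mem_grid)
    finally show "a \<le> a'" unfolding j(2)[symmetric] letter_def by (rule Least_le)
  qed
  have red_rows: "a < a'" if "(i, j) \<in> grid r d" "(i, j') \<in> grid r d" "j < j'"
    "?T (i, j) = Red a" "?T (i, j') = Red a'" for i j j' a a'
    using that letter_strict_mono[of j j' w i g] by (auto simp: red)
  have red_cond: "red_condition g r d ?T"
    unfolding red_condition_def
    using part red_boxes red_cols red_rows letters card_fibre by blast
  have box: "(i, d - r - 1 - j) \<in> boxes (r + 1) (blue_shape g r d w)"
    if "(i, j) \<in> grid r d" "others w i g \<le> j" for i j
    using that by (auto simp: boxes_def blue_shape_def mem_grid)
  have "blue_condition r d ?T"
    unfolding blue_condition_def
  proof (intro conjI allI ballI impI)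
    fix b a assume "b \<in> grid r d" "?T b = Blue a"
    then have "f (fst b, d - r - 1 - snd b) = a" "(fst b, d - r - 1 - snd b) \<in> boxes (r + 1) (blue_shape g r d w)"
      using blue[of "fst b" "snd b" a] box[of "fst b" "snd b"] by auto
    then show "a \<in> {0..r}" using f by (force simp: semistandard_def PiE_iff)
  next
    fix i i' j a a'
    assume *: "(i, j) \<in> grid r d \<and> (i', j) \<in> grid r d \<and> i < i' \<and> ?T (i, j) = Blue a \<and> ?T (i', j) = Blue a'"
    then show "a < a'" using f box[of i j] box[of i' j] by (auto simp: semistandard_def blue)
  next
    fix i j j' a a'
    assume *: "(i, j) \<in> grid r d \<and> (i, j') \<in> grid r d \<and> j < j' \<and> ?T (i, j) = Blue a \<and> ?T (i, j') = Blue a'"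
    then have "d - r - 1 - j' < d - r - 1 - j" by (auto simp: mem_grid)
    then show "a \<le> a'" using * f box[of i j] by (auto simp: semistandard_def blue)
  qed
  then show ?thesis using card_red card_blue red_cond
    by (auto simp: L_tableaux_def tableau_of_def)
qed

text \<open>
  The word is recovered from the tableau because \<open>w a\<close> is the only row without the letter \<open>a\<close>.
\<close>

lemma inj_on_tableau_of:
  assumes "g \<le> d - r"
  shows "inj_on (tableau_of g r d)
    (SIGMA w:ballot_words (r + 1) g. semistandard (r + 1) (blue_shape g r d w))"
proof (rule inj_onI, clarify)
  fix w f w' f'
  assume w: "w \<in> ballot_words (r + 1) g" and w': "w' \<in> ballot_words (r + 1) g"
    and f: "f \<in> semistandard (r + 1) (blue_shape g r d w)"
    and f': "f' \<in> semistandard (r + 1) (blue_shape g r d w')"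
    and eq: "tableau_of g r d (w, f) = tableau_of g r d (w', f')"
  have "w a = w' a" if a: "a \<in> {1..g}" for a
  proof (rule ccontr)
    let ?i = "w' a"
    let ?j = "others w ?i (a - 1)"
    assume ne: "w a \<noteq> w' a"
    have i: "?i < r + 1" using w' a by (auto simp: ballot_words_def PiE_iff)
    have j: "?j < others w ?i g" using others_less[of a g w ?i] a ne by simp
    then have "?j < d - r" using others_le[of w ?i g] assms by simp
    then have "Red a = tableau_of g r d (w', f') (?i, ?j)"
      using eq tableau_of_apply[OF i, of ?j d g w f] letter_others[of a w ?i] a ne j by simp
    then have "?j < others w' ?i g" "letter w' ?i ?j = a"
      using tableau_of_apply[OF i \<open>?j < d - r\<close>, of g w' f'] by (auto split: if_splits)
    then show False using letter_props(2)[of ?j w' ?i g] by simp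
  qed
  then have ww: "w = w'"
    using w w' by (intro extensionalityI[of _ "{1..g}"]) (auto simp: ballot_words_def PiE_iff)
  moreover have "f = f'"
  proof (rule extensionalityI[of _ "boxes (r + 1) (blue_shape g r d w)"])
    show "f \<in> extensional (boxes (r + 1) (blue_shape g r d w))"
      "f' \<in> extensional (boxes (r + 1) (blue_shape g r d w))"
      using f f' ww by (auto simp: semistandard_def PiE_iff)
    fix x assume "x \<in> boxes (r + 1) (blue_shape g r d w)"
    then obtain i j where x: "x = (i, j)" "i < r + 1" "j < d - r - others w i g"
      by (auto simp: boxes_def blue_shape_def)
    let ?j = "d - r - 1 - j"
    have "?j < d - r" "\<not> ?j < others w i g" "d - r - 1 - ?j = j" using x by auto
    then show "f x = f' x"
      using fun_cong[OF eq, of "(i, ?j)"] tableau_of_apply[OF x(2), of ?j d g w f]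
        tableau_of_apply[OF x(2), of ?j d g w' f'] ww x by simp
  qed
  ultimately show "w = w' \<and> f = f'" by simp
qed

text \<open>
  Everything rests on one count: the letters up to \<open>k\<close> in row \<open>i\<close> correspond to the red boxes of
  that row with entry at most \<open>k\<close> (\<open>others_eq\<close> below). Taken at \<open>k = g\<close> it gives the red row lengths; compared
  between two rows it gives the ballot condition, since entries weakly increase up columns; taken at
  an entry of the row it shows that the entry is the one prescribed by \<open>letter\<close>.
\<close>

lemma L_tableaux_surj:
  assumes T: "T \<in> L_tableaux g r d"
  shows "T \<in> tableau_of g r d `
    (SIGMA w:ballot_words (r + 1) g. semistandard (r + 1) (blue_shape g r d w))"
proof -
  have "red_condition g r d T" and blue_cond: "blue_condition r d T"
    and ext: "T \<in> extensional (grid r d)"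
    using T by (auto simp: L_tableaux_def PiE_iff)
  note red_cond = \<open>red_condition g r d T\<close>[unfolded red_condition_def is_partition_def]
  obtain p where p: "antimono p" "red_boxes r d T = young_diagram p"
    using conjunct1[OF red_cond] by blast
  have rows: "a < a'" if "(i, j) \<in> grid r d" "(i, j') \<in> grid r d" "j < j'"
    "T (i, j) = Red a" "T (i, j') = Red a'" for i j j' a a'
    using conjunct1[OF conjunct2[OF conjunct2[OF red_cond]]] that by blast
  have cols: "a \<le> a'" if "(i, j) \<in> grid r d" "(i', j) \<in> grid r d" "i < i'"
    "T (i, j) = Red a" "T (i', j) = Red a'" for i i' j a a'
    using conjunct1[OF conjunct2[OF red_cond]] that by blast
  have range: "a \<in> {1..g}" if "b \<in> grid r d" "T b = Red a" for a b
    using conjunct1[OF conjunct2[OF conjunct2[OF conjunct2[OF red_cond]]]] that by blast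
  have mult: "card {b \<in> grid r d. T b = Red a} = r" if "a \<in> {1..g}" for a
    using conjunct2[OF conjunct2[OF conjunct2[OF conjunct2[OF red_cond]]]] that by blast
  define l where "l = (\<lambda>i j. case T (i, j) of Red a \<Rightarrow> a | Blue _ \<Rightarrow> 0)"
  have red: "(i, j) \<in> grid r d" "T (i, j) = Red (l i j)" if "j < p i" for i j
  proof -
    have "(i, j) \<in> red_boxes r d T" using that p by (simp add: young_diagram_def)
    then show "(i, j) \<in> grid r d" "T (i, j) = Red (l i j)" by (auto simp: red_boxes_def l_def)
  qed
  have red_iff: "j < p i \<longleftrightarrow> (\<exists>a. T (i, j) = Red a)" if "(i, j) \<in> grid r d" for i j
  proof -
    have "(i, j) \<in> red_boxes r d T \<longleftrightarrow> j < p i" by (simp add: p young_diagram_def)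
    then show ?thesis using that by (auto simp: red_boxes_def)
  qed
  have l_range: "l i j \<in> {1..g}" if "j < p i" for i j using range red[OF that] by blast
  have l_rows: "l i j < l i j'" if "j < j'" "j' < p i" for i j j'
    using rows[of i j j'] red[of j i] red[of j' i] that by simp
  have l_cols: "l i j \<le> l i' j" if "i < i'" "j < p i'" for i i' j
  proof -
    have "p i' \<le> p i" using antimonoD[OF p(1), of i i'] that by simp
    then show ?thesis using cols[of i j i'] red[of j i] red[of j i'] that by simp
  qed
  have l_inj: "j = j'" if "l i j = l i j'" "j < p i" "j' < p i" for i j j'
    using l_rows[of j j' i] l_rows[of j' j i] that by (cases j j' rule: linorder_cases) auto
  \<comment> \<open>Each letter is missing from exactly one row.\<close>
  have "\<exists>x. {..<r + 1} - {i. \<exists>j<p i. l i j = a} = {x}" if a: "a \<in> {1..g}" for a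
  proof -
    let ?F = "{b \<in> grid r d. T b = Red a}"
    let ?R = "{i. \<exists>j<p i. l i j = a}"
    have "?R = fst ` ?F"
    proof (intro set_eqI iffI)
      fix i assume "i \<in> ?R"
      then obtain j where "j < p i" "l i j = a" by blast
      then show "i \<in> fst ` ?F" using red[of j i] by (intro image_eqI[of _ _ "(i, j)"]) auto
    next
      fix i assume "i \<in> fst ` ?F"
      then obtain j where j: "(i, j) \<in> grid r d" "T (i, j) = Red a" by auto
      then show "i \<in> ?R" using red_iff[of i j] by (auto simp: l_def intro!: exI[of _ j])
    qed
    moreover have "inj_on fst ?F"
    proof (rule inj_onI)
      fix x y assume xy: "x \<in> ?F" "y \<in> ?F" "fst x = fst y"
      obtain i j j' where "x = (i, j)" "y = (i, j')" using xy(3) by (metis prod.collapse)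
      then show "x = y"
        using xy rows[of i j j' a a] rows[of i j' j a a] by (cases j j' rule: linorder_cases) auto
    qed
    ultimately have "card ?R = r" using mult[OF a] by (simp add: card_image)
    moreover have "?R \<subseteq> {..<r + 1}" using red(1) by (auto simp: mem_grid)
    moreover from this have "finite ?R" by (rule finite_subset) simp
    ultimately have "card ({..<r + 1} - ?R) = 1" by (simp add: card_Diff_subset)
    then show ?thesis by (rule card_1_singletonE) blast
  qed
  then have "\<forall>a\<in>{1..g}. \<exists>x. {..<r + 1} - {i. \<exists>j<p i. l i j = a} = {x}" by blast
  from bchoice[OF this] obtain w0
    where "\<forall>a\<in>{1..g}. {..<r + 1} - {i. \<exists>j<p i. l i j = a} = {w0 a}" by blast
  then have w0: "{..<r + 1} - {i. \<exists>j<p i. l i j = a} = {w0 a}" if "a \<in> {1..g}" for a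
    using that by blast
  define w where "w = restrict w0 {1..g}"
  have w: "w a \<noteq> i \<longleftrightarrow> (\<exists>j<p i. l i j = a)" if "a \<in> {1..g}" "i < r + 1" for a i
  proof -
    have "i \<in> {..<r + 1} - {i. \<exists>j<p i. l i j = a} \<longleftrightarrow> i = w a"
      unfolding w0[OF that(1)] using that(1) by (simp add: w_def)
    then show ?thesis using that(2) by blast
  qed
  have others_eq: "others w i k = card {j. j < p i \<and> l i j \<le> k}" if "i < r + 1" "k \<le> g" for i k
  proof -
    have "{a \<in> {1..k}. w a \<noteq> i} = l i ` {j. j < p i \<and> l i j \<le> k}"
    proof (intro set_eqI iffI)
      fix a assume "a \<in> {a \<in> {1..k}. w a \<noteq> i}"
      then show "a \<in> l i ` {j. j < p i \<and> l i j \<le> k}" using w[of a i] that by auto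
    next
      fix a assume "a \<in> l i ` {j. j < p i \<and> l i j \<le> k}"
      then obtain j where j: "j < p i" "l i j \<le> k" "a = l i j" by blast
      then show "a \<in> {a \<in> {1..k}. w a \<noteq> i}" using w[of a i] l_range[of j i] that by auto
    qed
    moreover have "inj_on (l i) {j. j < p i \<and> l i j \<le> k}" using l_inj by (auto intro!: inj_onI)
    ultimately show ?thesis by (simp add: others_def card_image)
  qed
  have others_g: "others w i g = p i" if "i < r + 1" for i
  proof -
    have "{j. j < p i \<and> l i j \<le> g} = {..<p i}" using l_range by auto
    then show ?thesis using others_eq[OF that order_refl] by simp
  qed
  have "w \<in> {1..g} \<rightarrow>\<^sub>E {..<r + 1}"
  proof (rule PiE_I)
    fix a assume "a \<in> {1..g}"
    then show "w a \<in> {..<r + 1}" using w0[of a] by (simp add: w_def) blast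
  qed (auto simp: w_def)
  moreover have "others w i' k \<le> others w i k" if "k \<le> g" "i < i'" "i' < r + 1" for i i' k
  proof -
    have "p i' \<le> p i" using antimonoD[OF p(1), of i i'] that by simp
    then have "{j. j < p i' \<and> l i' j \<le> k} \<subseteq> {j. j < p i \<and> l i j \<le> k}"
      using l_cols[of i i'] that by (auto intro: order_trans)
    then have "card {j. j < p i' \<and> l i' j \<le> k} \<le> card {j. j < p i \<and> l i j \<le> k}"
      by (intro card_mono) auto
    then show ?thesis using others_eq that by simp
  qed
  ultimately have w_ballot: "w \<in> ballot_words (r + 1) g" by (auto simp: ballot_words_def)
  have letter: "letter w i j = l i j" if "j < p i" for i j
  proof -
    have i: "i < r + 1" using red(1)[OF that] by (simp add: mem_grid)
    have le: "l i j' \<le> l i j \<longleftrightarrow> j' \<le> j" if "j' < p i" for j'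
      using l_rows[of j j' i] l_rows[of j' j i] that \<open>j < p i\<close>
      by (cases j j' rule: linorder_cases) auto
    have "{j'. j' < p i \<and> l i j' \<le> l i j} = {..j}" using le that by auto
    then have "others w i (l i j) = Suc j" using others_eq[OF i, of "l i j"] l_range[OF that] by simp
    moreover have "w (l i j) \<noteq> i" "1 \<le> l i j" using w[OF _ i] l_range[OF that] that by auto
    moreover from calculation have "others w i (l i j - 1) = j"
      by (cases "l i j") (auto simp: others_Suc)
    ultimately show ?thesis using letter_others[of "l i j" w i] by simp
  qed
  define f where "f = (\<lambda>(i, j)\<in>boxes (r + 1) (blue_shape g r d w).
      case T (i, d - r - 1 - j) of Red _ \<Rightarrow> 0 | Blue a \<Rightarrow> a)"
  have box: "(i, d - r - 1 - j) \<in> grid r d" "T (i, d - r - 1 - j) = Blue (f (i, j))"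
    if "(i, j) \<in> boxes (r + 1) (blue_shape g r d w)" for i j
  proof -
    have ij: "i < r + 1" "j < d - r - p i" using that others_g by (auto simp: boxes_def blue_shape_def)
    then show grid: "(i, d - r - 1 - j) \<in> grid r d" by (auto simp: mem_grid)
    have "\<not> d - r - 1 - j < p i" using ij by auto
    then show "T (i, d - r - 1 - j) = Blue (f (i, j))"
      using red_iff[OF grid] that by (auto simp: f_def split: entry.split)
  qed
  have f_range: "f (i, j) < r + 1" if "(i, j) \<in> boxes (r + 1) (blue_shape g r d w)" for i j
    using blue_cond box[OF that] unfolding blue_condition_def by fastforce
  have f_cols: "f (i, j) < f (i', j)" if "i < i'" "(i, j) \<in> boxes (r + 1) (blue_shape g r d w)"
    "(i', j) \<in> boxes (r + 1) (blue_shape g r d w)" for i i' j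
    using blue_cond box[OF that(2)] box[OF that(3)] that(1) unfolding blue_condition_def by blast
  have f_rows: "f (i, j') \<le> f (i, j)" if "j < j'" "(i, j') \<in> boxes (r + 1) (blue_shape g r d w)" for i j j'
  proof -
    have "(i, j) \<in> boxes (r + 1) (blue_shape g r d w)" "d - r - 1 - j' < d - r - 1 - j"
      using that by (auto simp: boxes_def blue_shape_def)
    then show ?thesis
      using blue_cond box[of i j] box[OF that(2)] unfolding blue_condition_def by blast
  qed
  have "f \<in> extensional (boxes (r + 1) (blue_shape g r d w))" by (simp add: f_def)
  then have "f \<in> semistandard (r + 1) (blue_shape g r d w)"
    using f_range f_cols f_rows by (auto simp: semistandard_def PiE_iff)
  moreover have "T = tableau_of g r d (w, f)"
  proof (rule extensionalityI[of _ "grid r d"])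
    show "T \<in> extensional (grid r d)" by (rule ext)
    show "tableau_of g r d (w, f) \<in> extensional (grid r d)" by (simp add: tableau_of_def)
    fix x assume "x \<in> grid r d"
    then obtain i j where x: "x = (i, j)" "(i, j) \<in> grid r d" "i < r + 1" "j < d - r"
      by (cases x) (auto simp: mem_grid)
    show "T x = tableau_of g r d (w, f) x"
    proof (cases "j < p i")
      case True
      then show ?thesis using x letter red(2) others_g by (simp add: tableau_of_apply)
    next
      case False
      have "(i, d - r - 1 - j) \<in> boxes (r + 1) (blue_shape g r d w)" "d - r - 1 - (d - r - 1 - j) = j"
        using False x others_g by (auto simp: boxes_def blue_shape_def)
      then show ?thesis using box(2)[of i "d - r - 1 - j"] False x others_g
        by (simp add: tableau_of_apply)
    qed
  qed
  ultimately show ?thesis using w_ballot by (intro image_eqI[of _ _ "(w, f)"]) auto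
qed

theorem theorem1p3:
  fixes g r d :: nat
  assumes "r \<ge> 1" and "d \<ge> g + r"
  shows "card (L_tableaux g r d) = (r + 1) ^ g"
proof -
  let ?n = "r + 1"
  let ?D = "SIGMA w:ballot_words ?n g. semistandard ?n (blue_shape g r d w)"
  have m: "g \<le> d - r" using assms by simp
  have "tableau_of g r d ` ?D = L_tableaux g r d"
    using tableau_of_in_L_tableaux[OF m] L_tableaux_surj by auto
  then have "card (L_tableaux g r d) = card ?D"
    using card_image[OF inj_on_tableau_of[OF m]] by simp
  also have "\<dots> = (\<Sum>w\<in>ballot_words ?n g. card (semistandard ?n (blue_shape g r d w)))"
    by (simp add: finite_ballot_words finite_semistandard)
  also have "\<dots> = (\<Sum>w\<in>ballot_words ?n g. gt_count ?n (\<lambda>i. (d - r - g) + (g - others w i g)))"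
  proof (rule sum.cong[OF refl])
    fix w assume w: "w \<in> ballot_words ?n g"
    have "others w (Suc i) g \<le> others w i g" if "Suc i < ?n" for i
      using w that by (auto simp: ballot_words_def)
    then have "card (semistandard ?n (blue_shape g r d w)) = gt_count ?n (blue_shape g r d w)"
      by (intro card_semistandard) (simp add: blue_shape_def diff_le_mono2)
    moreover have "blue_shape g r d w = (\<lambda>i. (d - r - g) + (g - others w i g))"
      using m others_le[of w _ g] by (auto simp: blue_shape_def)
    ultimately show "card (semistandard ?n (blue_shape g r d w)) =
        gt_count ?n (\<lambda>i. (d - r - g) + (g - others w i g))" by simp
  qed
  also have "\<dots> = ?n ^ g" by (rule sum_gt_count_ballot_words)
  finally show ?thesis .
qed

end
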